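(* Let $\{X_t : t \in T\}$ be any family of scattered Eberlein compact spaces. Then every $\sigma$-product of this family is a $\Delta$-space.
   Context: A topological space $X$ is a $\Delta$-space if for every decreasing sequence $\{D_n: n \in \omega\}$ of subsets of $X$ with empty intersection there is a decreasing sequence $\{V_n: n \in \omega\}$ of open subsets of $X$, also with empty intersection, such that $D_n \subset V_n$ for every $n \in \omega$. A $\sigma$-product of a family $\{X_t : t\in T\}$ is, for some fixed base point $a \in \prod_{t\in T} X_t$, the subspace $\{x \in \prod_{t\in T}X_t : \{t \in T : x(t)\neq a(t)\} \text{ is finite}\}$ of the Tychonoff product. An Eberlein compact is a compact Hausdorff space homeomorphic to a weakly compact subset of a Banach space. A space is scattered if every nonempty subset $A$ of it has a point isolated in $A$. *)

theory Defs
  imports "HOL-Analysis.Analysis"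
begin

definition delta_space :: "'a topology \<Rightarrow> bool" where
  "delta_space X \<longleftrightarrow>
     (\<forall>D :: nat \<Rightarrow> 'a set.
        decseq D \<and> (\<forall>n. D n \<subseteq> topspace X) \<and> (\<Inter>n. D n) = {} \<longrightarrow>
        (\<exists>V. decseq V \<and> (\<forall>n. openin X (V n)) \<and> (\<Inter>n. V n) = {} \<and> (\<forall>n. D n \<subseteq> V n)))"

definition scattered_space :: "'a topology \<Rightarrow> bool" where
  "scattered_space X \<longleftrightarrow>
     (\<forall>A. A \<subseteq> topspace X \<and> A \<noteq> {} \<longrightarrow> (\<exists>x\<in>A. openin (subtopology X A) {x}))"

definition sigma_product :: "('i \<Rightarrow> 'a topology) \<Rightarrow> 'i set \<Rightarrow> ('i \<Rightarrow> 'a) \<Rightarrow> ('i \<Rightarrow> 'a) topology" where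
  "sigma_product X T a =
     subtopology (product_topology X T)
       {x \<in> topspace (product_topology X T). finite {t \<in> T. x t \<noteq> a t}}"

(* A Banach space is a linear subspace V of an ambient real vector space with a complete norm N
   on V; the ambient space itself carries no norm or topology. This is used instead of the type
   class banach because the members of a family may live in different Banach spaces, and any
   family of Banach spaces has isomorphic copies inside one ambient vector space (the algebraic
   direct sum), each with its own norm. Values of N outside V are irrelevant. *)

definition banach_space_on :: "'b::real_vector set \<Rightarrow> ('b \<Rightarrow> real) \<Rightarrow> bool" where
  "banach_space_on V N \<longleftrightarrow>
     subspace V \<and>
     (\<forall>x\<in>V. 0 \<le> N x \<and> (N x = 0 \<longleftrightarrow> x = 0)) \<and>
     (\<forall>c. \<forall>x\<in>V. N (c *\<^sub>R x) = \<bar>c\<bar> * N x) \<and>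
     (\<forall>x\<in>V. \<forall>y\<in>V. N (x + y) \<le> N x + N y) \<and>
     (\<forall>s :: nat \<Rightarrow> 'b.
        (\<forall>n. s n \<in> V) \<and> (\<forall>e>0. \<exists>M. \<forall>m\<ge>M. \<forall>n\<ge>M. N (s m - s n) < e) \<longrightarrow>
        (\<exists>l\<in>V. (\<lambda>n. N (s n - l)) \<longlonglongrightarrow> 0))"

definition bounded_functionals_on :: "'b::real_vector set \<Rightarrow> ('b \<Rightarrow> real) \<Rightarrow> ('b \<Rightarrow> real) set" where
  "bounded_functionals_on V N =
     {f. (\<forall>x\<in>V. \<forall>y\<in>V. f (x + y) = f x + f y) \<and>
         (\<forall>c. \<forall>x\<in>V. f (c *\<^sub>R x) = c * f x) \<and>
         (\<exists>C. \<forall>x\<in>V. \<bar>f x\<bar> \<le> C * N x)}"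

definition weak_topology_on :: "'b::real_vector set \<Rightarrow> ('b \<Rightarrow> real) \<Rightarrow> 'b topology" where
  "weak_topology_on V N =
     topology_generated_by
       {{x \<in> V. f x \<in> U} | f U. f \<in> bounded_functionals_on V N \<and> open U}"

(* The type argument only provides the ambient vector space in which the Banach space is sought. *)

definition eberlein_compact :: "'b::real_vector itself \<Rightarrow> 'a topology \<Rightarrow> bool" where
  "eberlein_compact TYPE('b) X \<longleftrightarrow>
     compact_space X \<and> Hausdorff_space X \<and>
     (\<exists>(V :: 'b set) N K.
        banach_space_on V N \<and> compactin (weak_topology_on V N) K \<and>
        X homeomorphic_space subtopology (weak_topology_on V N) K)"

lemma topspace_weak_topology_on [simp]: "topspace (weak_topology_on V N) = V"
proof -
  have "(\<lambda>x. 0) \<in> bounded_functionals_on V N"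
    by (auto simp: bounded_functionals_on_def intro: exI[of _ 0])
  then have "V \<in> {{x \<in> V. f x \<in> U} | f U. f \<in> bounded_functionals_on V N \<and> open U}"
    by (intro CollectI exI[of _ "\<lambda>x. 0"] exI[of _ UNIV]) auto
  then show ?thesis
    unfolding weak_topology_on_def topology_generated_by_topspace by blast
qed

lemma banach_space_on_UNIV: "banach_space_on (UNIV :: 'b::banach set) norm"
proof -
  have "\<exists>l. (\<lambda>n. norm (s n - l)) \<longlonglongrightarrow> 0"
    if "\<forall>e>0. \<exists>M. \<forall>m\<ge>M. \<forall>n\<ge>M. norm (s m - s n) < e" for s :: "nat \<Rightarrow> 'b"
  proof -
    have "Cauchy s" using that by (simp add: Cauchy_def dist_norm)
    then obtain l where "s \<longlonglongrightarrow> l" using Cauchy_convergent convergent_def by blast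
    then show ?thesis using LIM_zero tendsto_norm_zero by blast
  qed
  then show ?thesis by (auto simp: banach_space_on_def norm_triangle_ineq)
qed

end

theory Submission
  imports Defs "HOL-Algebra.Free_Abelian_Groups"
begin

text \<open>
  The notion that does the work is an assignment of an open neighbourhood to every point such that
  each point of the space lies in only finitely many of the assigned sets. Replacing each \<open>D n\<close> by
  the union of the neighbourhoods of its points then yields the open sets that a \<open>\<Delta>\<close>-space asks for
  (\<open>point_finite_nbhds_imp_delta_space\<close>). Such assignments pass to \<open>\<sigma>\<close>-products because the
  neighbourhood of \<open>x\<close> can be made to force the support of \<open>x\<close> into the support of each of its members
  (\<open>point_finite_nbhds_sigma_product\<close>). It remains to treat a single scattered Eberlein compact
  space \<open>X\<close>.

  A weakly compact subset of a Banach space is separated by the unit ball of the dual. By Tychonoff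
  this gives a pointwise compact set \<open>L\<close> of continuous functions that separates the points of \<open>X\<close>
  (\<open>eberlein_compact_separating_functions\<close>).
  The duality between the compact sets \<open>X\<close> and \<open>L\<close> makes a Loewenheim-Skolem argument possible:
  a set \<open>A \<subseteq> X\<close> that is closed under suitable finitary operations, countably many in each arity,
  is the image of a continuous retraction of \<open>X\<close>. The retraction onto a smaller such set factors
  through the one onto a larger set, and each set \<open>S\<close> lies in such an \<open>A\<close> that is no larger than
  \<open>S\<close>, up to \<open>\<aleph>\<^sub>0\<close>.

  Scatteredness enters through a well-order of \<open>X\<close> whose initial segments are open: every nonempty
  closed set has a last point in it, and putting these last points into \<open>A\<close> makes \<open>A\<close> itself
  closed, rather than just dense in the image of the retraction. Unions of chains of such sets are
  therefore closed again. So if \<open>X\<close> is exhausted by a well-ordered increasing family of sets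
  \<open>N b\<close>, then for each \<open>y\<close> there are only finitely many \<open>b\<close> for which the retract of \<open>y\<close> onto
  \<open>N b\<close> is new, that is, not in an earlier set. Pulling back point-finite assignments from the
  smaller spaces \<open>N b\<close>, restricted to their new points, gives one for \<open>X\<close>, by induction on the
  cardinality (\<open>point_finite_nbhds_compact_separation\<close>). Countable spaces start the induction.
\<close>

section \<open>Point-finite neighbourhood assignments\<close>

definition point_finite_nbhds :: "'a topology \<Rightarrow> bool" where
  "point_finite_nbhds X \<longleftrightarrow>
     (\<exists>U. (\<forall>x\<in>topspace X. openin X (U x) \<and> x \<in> U x) \<and>
          (\<forall>y\<in>topspace X. finite {x \<in> topspace X. y \<in> U x}))"

text \<open>
  A point that lies in the neighbourhood of some member of every \<open>D n\<close> would, since only finitely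
  many members are available to it, see one of them in infinitely many \<open>D n\<close>, hence in all.
\<close>
lemma point_finite_nbhds_imp_delta_space:
  assumes "point_finite_nbhds X"
  shows "delta_space X"
  unfolding delta_space_def
proof (intro allI impI, elim conjE)
  fix D :: "nat \<Rightarrow> 'a set"
  assume D: "decseq D" "\<forall>n. D n \<subseteq> topspace X" "(\<Inter>n. D n) = {}"
  obtain U where U: "\<And>x. x \<in> topspace X \<Longrightarrow> openin X (U x) \<and> x \<in> U x"
    and fin: "\<And>y. y \<in> topspace X \<Longrightarrow> finite {x \<in> topspace X. y \<in> U x}"
    using assms unfolding point_finite_nbhds_def by blast
  define V where "V n = (\<Union>x\<in>D n. U x)" for n
  have "openin X (V n)" for n
    unfolding V_def using U D(2) by blast
  moreover have "D n \<subseteq> V n" for n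
    unfolding V_def using U D(2) by blast
  moreover have "decseq V"
    using D(1) unfolding V_def decseq_def by blast
  moreover have "(\<Inter>n. V n) = {}"
  proof (rule ccontr)
    assume "(\<Inter>n. V n) \<noteq> {}"
    then obtain y where y: "\<And>n. y \<in> V n" by blast
    then have "y \<in> topspace X"
      using \<open>openin X (V 0)\<close> openin_subset by blast
    define S where "S = {x \<in> topspace X. y \<in> U x}"
    have "finite S" using fin \<open>y \<in> topspace X\<close> by (simp add: S_def)
    have "\<forall>x. \<exists>n. x \<notin> D n" using D(3) by blast
    then obtain k where k: "\<And>x. x \<notin> D (k x)" by metis
    define m where "m = Max (insert 0 (k ` S))"
    obtain x where x: "x \<in> D m" "y \<in> U x" using y[of m] by (auto simp: V_def)
    then have "x \<in> S" using D(2) by (auto simp: S_def)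
    then have "k x \<le> m" using \<open>finite S\<close> by (simp add: m_def)
    then have "D m \<subseteq> D (k x)" using D(1) by (simp add: decseq_def)
    then show False using x k by blast
  qed
  ultimately show "\<exists>V. decseq V \<and> (\<forall>n. openin X (V n)) \<and> (\<Inter>n. V n) = {} \<and> (\<forall>n. D n \<subseteq> V n)"
    by blast
qed

text \<open>
  The neighbourhood of \<open>x\<close> constrains the coordinates in the support of \<open>x\<close> only, and keeps them
  away from the base point. A point \<open>y\<close> therefore only meets neighbourhoods of points supported in
  the finite support of \<open>y\<close>, with finitely many possible values at each coordinate.
\<close>
lemma point_finite_nbhds_sigma_product:
  assumes X: "\<And>t. t \<in> T \<Longrightarrow> point_finite_nbhds (X t)" "\<And>t. t \<in> T \<Longrightarrow> t1_space (X t)"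
    and a: "a \<in> topspace (product_topology X T)"
  shows "point_finite_nbhds (sigma_product X T a)"
proof -
  obtain U where U: "\<And>t x. t \<in> T \<Longrightarrow> x \<in> topspace (X t) \<Longrightarrow> openin (X t) (U t x) \<and> x \<in> U t x"
    and fin: "\<And>t y. t \<in> T \<Longrightarrow> y \<in> topspace (X t) \<Longrightarrow> finite {x \<in> topspace (X t). y \<in> U t x}"
    using X(1) unfolding point_finite_nbhds_def by metis
  define Z where "Z = sigma_product X T a"
  define supp where "supp x = {t \<in> T. x t \<noteq> a t}" for x
  have topZ: "topspace Z = {x \<in> topspace (product_topology X T). finite (supp x)}"
    unfolding Z_def sigma_product_def supp_def topspace_subtopology by blast
  define O' where "O' x = {y \<in> topspace Z. \<forall>t\<in>supp x. y t \<in> U t (x t) - {a t}}" for x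
  have "openin Z (O' x) \<and> x \<in> O' x" if x: "x \<in> topspace Z" for x
  proof
    have xt: "x t \<in> topspace (X t)" if "t \<in> T" for t
      using x that by (auto simp: topZ)
    have "openin Z {y \<in> topspace Z. y t \<in> U t (x t) - {a t}}" if t: "t \<in> supp x" for t
    proof (rule openin_continuous_map_preimage)
      have "t \<in> T" using t by (simp add: supp_def)
      then show "continuous_map Z (X t) (\<lambda>y. y t)"
        unfolding Z_def sigma_product_def
        by (intro continuous_map_from_subtopology continuous_map_product_projection)
      have "closedin (X t) {a t}"
        using a \<open>t \<in> T\<close> X(2) by (auto intro!: closedin_t1_singleton)
      then show "openin (X t) (U t (x t) - {a t})"
        using U \<open>t \<in> T\<close> xt by blast
    qed
    then have "openin Z (topspace Z \<inter> \<Inter>((\<lambda>t. {y \<in> topspace Z. y t \<in> U t (x t) - {a t}}) ` supp x))"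
      using x topZ by (intro openin_Int_Inter openin_topspace) blast+
    also have "topspace Z \<inter> \<Inter>((\<lambda>t. {y \<in> topspace Z. y t \<in> U t (x t) - {a t}}) ` supp x) = O' x"
      by (auto simp: O'_def)
    finally show "openin Z (O' x)" .
    show "x \<in> O' x"
      using x U xt by (auto simp: O'_def supp_def)
  qed
  moreover have "finite {x \<in> topspace Z. y \<in> O' x}" if y: "y \<in> topspace Z" for y
  proof -
    define C where "C t = insert (a t) {x \<in> topspace (X t). y t \<in> U t x}" for t
    have "finite (supp y)" using y by (simp add: topZ)
    moreover have "finite (C t)" if "t \<in> supp y" for t
      using y that fin[of t "y t"] by (auto simp: topZ C_def supp_def)
    ultimately have "finite (Pi\<^sub>E (supp y) C)"
      by (intro finite_PiE)
    moreover have "{x \<in> topspace Z. y \<in> O' x} \<subseteq> (\<lambda>f t. if t \<in> supp y then f t else a t) ` Pi\<^sub>E (supp y) C"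
    proof safe
      fix x assume x: "x \<in> topspace Z" "y \<in> O' x"
      have sub: "supp x \<subseteq> supp y"
        using x by (auto simp: O'_def supp_def)
      have "x t \<in> C t" if "t \<in> supp y" for t
        using x that by (cases "t \<in> supp x") (auto simp: C_def O'_def supp_def topZ)
      then have "restrict x (supp y) \<in> Pi\<^sub>E (supp y) C" by auto
      moreover have "x = (\<lambda>t. if t \<in> supp y then restrict x (supp y) t else a t)"
      proof
        fix t
        show "x t = (if t \<in> supp y then restrict x (supp y) t else a t)"
        proof (cases "t \<in> T")
          case True
          then show ?thesis using sub by (auto simp: supp_def)
        next
          case False
          then have "x t = undefined" "a t = undefined"
            using x(1) a by (auto simp: topZ PiE_def extensional_def)
          then show ?thesis using False by (simp add: supp_def)
        qed
      qed
      ultimately show "x \<in> (\<lambda>f t. if t \<in> supp y then f t else a t) ` Pi\<^sub>E (supp y) C"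
        by (intro image_eqI[where x = "restrict x (supp y)"])
    qed
    ultimately show ?thesis
      using finite_surj by blast
  qed
  ultimately show ?thesis
    unfolding point_finite_nbhds_def Z_def by blast
qed

text \<open>The neighbourhood of a point omits the finitely many points enumerated before it.\<close>
lemma point_finite_nbhds_countable:
  assumes "t1_space X" "countable (topspace X)"
  shows "point_finite_nbhds X"
proof -
  define n where "n = to_nat_on (topspace X)"
  have inj: "inj_on n (topspace X)" using assms(2) inj_on_to_nat_on n_def by blast
  define U where "U x = topspace X - {y \<in> topspace X. n y < n x}" for x
  have fin: "finite {y \<in> topspace X. n y \<le> k}" for k
    by (rule finite_imageD[of n])
      (auto intro: finite_subset[of _ "{..k}"] inj_on_subset[OF inj])
  have "openin X (U x)" for x
  proof -
    have "finite {y \<in> topspace X. n y < n x}"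
      by (rule finite_subset[OF _ fin[of "n x"]]) auto
    then have "closedin X {y \<in> topspace X. n y < n x}"
      using assms(1) t1_space_closedin_finite by blast
    then show ?thesis by (auto simp: U_def)
  qed
  moreover have "finite {x \<in> topspace X. y \<in> U x}" if "y \<in> topspace X" for y
    by (rule finite_subset[OF _ fin[of "n y"]]) (auto simp: U_def that)
  ultimately show ?thesis
    unfolding point_finite_nbhds_def by (intro exI[of _ U]) (auto simp: U_def)
qed

section \<open>Right-separating well-orders of scattered spaces\<close>

lemma well_order_on_strict_part:
  assumes "well_order_on A r"
  shows "wf (r - Id)" "trans (r - Id)" "total_on A (r - Id)"
  using assms
  by (auto simp: well_order_on_def linear_order_on_def partial_order_on_def preorder_on_def
      total_on_def intro: trans_diff_Id)

text \<open>
  Remove isolated points of the remaining subspace one by one, transfinitely. The sets removed so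
  far are open, so the order of removal has open initial segments. The stages are indexed by a
  well-order of the powerset of the whole type, which by Cantor is long enough for the process to
  exhaust the space.
\<close>
lemma scattered_space_right_separated:
  fixes X :: "'a topology"
  assumes "scattered_space X"
  shows "\<exists>R. wf R \<and> trans R \<and> total_on (topspace X) R \<and>
     (\<forall>x\<in>topspace X. \<exists>W. openin X W \<and> x \<in> W \<and> (\<forall>w\<in>W. w = x \<or> (w, x) \<in> R))"
proof -
  obtain r :: "'a set rel" where r: "well_order_on UNIV r"
    using well_order_on by blast
  define s where "s = r - Id"
  note s = well_order_on_strict_part[OF r, folded s_def]
  have wfs: "wf s" and transs: "trans s" by (rule s)+
  have tots: "i = j \<or> (i, j) \<in> s \<or> (j, i) \<in> s" for i j
    using s(3) by (auto simp: total_on_def)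
  define isol where "isol A x \<longleftrightarrow> x \<in> A \<and> openin (subtopology X A) {x}" for A x
  define e where "e = wfrec s (\<lambda>f i. SOME x. isol (topspace X - f ` {j. (j, i) \<in> s}) x)"
  define rest where "rest i = topspace X - e ` {j. (j, i) \<in> s}" for i
  have e: "e i = (SOME x. isol (rest i) x)" for i
  proof -
    have "cut e s i ` {j. (j, i) \<in> s} = e ` {j. (j, i) \<in> s}"
      by (rule image_cong) (simp_all add: cut_def)
    then show ?thesis
      unfolding rest_def using wfrec[OF wfs] unfolding e_def by (metis (no_types, lifting))
  qed
  have isol: "isol (rest i) (e i)" if "rest i \<noteq> {}" for i
  proof -
    have "\<exists>x. isol (rest i) x"
      using assms that unfolding scattered_space_def isol_def rest_def by blast
    then show ?thesis unfolding e by (rule someI_ex)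
  qed
  have anti: "rest j \<subseteq> rest i" if "(i, j) \<in> s" for i j
    using that transs unfolding rest_def trans_def by blast
  have ne: "e i \<noteq> e j" if "(i, j) \<in> s" "rest j \<noteq> {}" for i j
  proof -
    have "e i \<in> e ` {k. (k, j) \<in> s}" using that(1) by blast
    moreover have "e j \<notin> e ` {k. (k, j) \<in> s}"
      using isol[OF that(2)] by (simp add: isol_def rest_def)
    ultimately show ?thesis by metis
  qed
  \<comment> \<open>Otherwise the removed points would inject the index set \<open>'a set\<close> into \<open>'a\<close>.\<close>
  have "\<exists>i. rest i = {}"
  proof (rule ccontr)
    assume "\<nexists>i. rest i = {}"
    then have "inj e"
      using ne tots by (metis injI)
    then show False
      using Cantors_theorem[of "UNIV :: 'a set"]
      by (metis Pow_UNIV inv_f_f surj_def surjI)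
  qed
  then obtain i0 where i0: "rest i0 = {}" and min: "\<And>i. (i, i0) \<in> s \<Longrightarrow> rest i \<noteq> {}"
    using wfE_min'[OF wfs, of "{i. rest i = {}}"] by (metis (mono_tags) empty_iff mem_Collect_eq)
  have "\<forall>x\<in>topspace X. \<exists>i. (i, i0) \<in> s \<and> e i = x"
    using i0 by (auto simp: rest_def)
  then obtain k where k: "\<And>x. x \<in> topspace X \<Longrightarrow> (k x, i0) \<in> s \<and> e (k x) = x"
    by metis
  have ke: "k (e i) = i" if "(i, i0) \<in> s" for i
  proof -
    have "e i \<in> topspace X"
      using isol[OF min[OF that]] by (simp add: isol_def rest_def)
    then show ?thesis
      using k[of "e i"] ne[of i "k (e i)"] ne[of "k (e i)" i] min tots that by metis
  qed
  define R where "R = inv_image s k"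
  have "wf R" using wfs by (simp add: R_def)
  moreover have "trans R"
    using transs by (simp add: R_def trans_inv_image)
  moreover have "total_on (topspace X) R"
    unfolding total_on_def R_def in_inv_image using tots k by metis
  moreover have "\<exists>W. openin X W \<and> x \<in> W \<and> (\<forall>w\<in>W. w = x \<or> (w, x) \<in> R)"
    if x: "x \<in> topspace X" for x
  proof -
    have "isol (rest (k x)) x"
      using isol[of "k x"] k[OF x] min by metis
    then obtain W where W: "openin X W" "{x} = W \<inter> rest (k x)"
      unfolding isol_def openin_subtopology by blast
    have "w = x \<or> (w, x) \<in> R" if w: "w \<in> W" for w
    proof (cases "w \<in> rest (k x)")
      case True
      then show ?thesis using W(2) w by blast
    next
      case False
      moreover have "w \<in> topspace X" using W(1) w openin_subset by blast
      ultimately obtain j where j: "(j, k x) \<in> s" "w = e j"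
        by (auto simp: rest_def)
      then have "(j, i0) \<in> s" using k[OF x] transs unfolding trans_def by blast
      then show ?thesis using ke j by (simp add: R_def)
    qed
    then show ?thesis using W by blast
  qed
  ultimately show ?thesis by blast
qed

section \<open>Cardinality of finitary closures\<close>

lemma Fpow_lepoll:
  assumes "A \<lesssim> C" "infinite C"
  shows "Fpow A \<lesssim> C"
proof -
  obtain f where f: "inj_on f A" "f ` A \<subseteq> C"
    using assms(1) by (auto simp: lepoll_def)
  have "Fpow A \<lesssim> Fpow C"
    unfolding lepoll_def
    using inj_on_image_Fpow[OF f(1)] image_Fpow_mono[OF f(2)] by blast
  also have "Fpow C \<lesssim> C"
    using eqpoll_Fpow[OF assms(2)] eqpoll_imp_lepoll by blast
  finally show ?thesis .
qed

lemma Times_lepoll: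
  assumes "A \<lesssim> C" "B \<lesssim> C" "infinite C"
  shows "A \<times> B \<lesssim> C"
proof -
  have "A \<times> B \<lesssim> C \<times> C" using assms(1,2) by (rule times_lepoll_mono)
  also have "C \<times> C \<lesssim> C"
    using card_of_Times_same_infinite[OF assms(3)] eqpoll_iff_card_of_ordIso eqpoll_imp_lepoll by blast
  finally show ?thesis .
qed

lemma UN_lepoll:
  assumes "\<And>i. i \<in> I \<Longrightarrow> A i \<lesssim> C" "I \<lesssim> C" "infinite C"
  shows "(\<Union>i\<in>I. A i) \<lesssim> C"
  using card_of_UNION_ordLeq_infinite[of C I A] assms
  unfolding lepoll_def card_of_ordLeq by blast

lemma Un_lepoll:
  assumes "A \<lesssim> C" "B \<lesssim> C" "infinite C"
  shows "A \<union> B \<lesssim> C"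
proof -
  have "(UNIV :: bool set) \<lesssim> C"
    using assms(3) by (intro finite_lepoll_infinite) auto
  then have "(\<Union>b. if b then A else B) \<lesssim> C"
    using assms by (intro UN_lepoll) auto
  also have "(\<Union>b. if b then A else B) = A \<union> B" by (auto split: if_splits)
  finally show ?thesis .
qed

section \<open>Retractions of a scattered compact space with a separating compact set of functions\<close>

lemma rat_interval_separating:
  fixes a b :: real
  assumes "a \<noteq> b"
  shows "\<exists>p q. of_rat p \<le> a \<and> a \<le> of_rat q \<and> \<not> (of_rat p \<le> b \<and> b \<le> of_rat q)"
proof (cases "a < b")
  case True
  obtain q where "a < of_rat q" "of_rat q < b" using of_rat_dense[OF True] by blast
  moreover obtain p where "of_rat p < a" using of_rat_dense[of "a - 1" a] by auto
  ultimately show ?thesis by (intro exI[of _ p] exI[of _ q]) auto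
next
  case False
  then have "b < a" using assms by simp
  then obtain p where "b < of_rat p" "of_rat p < a" using of_rat_dense by blast
  moreover obtain q where "a < of_rat q" using of_rat_dense[of a "a + 1"] by auto
  ultimately show ?thesis by (intro exI[of _ p] exI[of _ q]) auto
qed

text \<open>
  The relation \<open>R\<close> is a strict well-order of \<open>X\<close> with open initial segments. The functions in \<open>L\<close>
  and the order \<open>R\<close> are defined on the whole type, so that a closed subspace of \<open>X\<close> satisfies the
  same assumptions with the same \<open>L\<close> and \<open>R\<close>; the induction on the cardinality relies on this.
\<close>
locale compact_separation =
  fixes X :: "'a topology" and L :: "('a \<Rightarrow> real) set" and R :: "'a rel"
  assumes compact: "compact_space X"
    and Hausdorff: "Hausdorff_space X"
    and compact_L: "compact L"
    and cont: "\<And>l. l \<in> L \<Longrightarrow> continuous_map X euclideanreal l"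
    and separates: "\<And>x y. x \<in> topspace X \<Longrightarrow> y \<in> topspace X \<Longrightarrow> x \<noteq> y \<Longrightarrow> \<exists>l\<in>L. l x \<noteq> l y"
    and wf_R: "wf R" and trans_R: "trans R" and total_R: "total_on (topspace X) R"
    and right_separated: "\<And>x. x \<in> topspace X \<Longrightarrow>
        \<exists>W. openin X W \<and> x \<in> W \<and> (\<forall>w\<in>W. w = x \<or> (w, x) \<in> R)"
begin

lemma compact_separation_closed_subspace:
  assumes "closedin X A"
  shows "compact_separation (subtopology X A) L R"
proof
  show "compact_space (subtopology X A)"
    using assms closedin_compact_space compact compact_space_subtopology by blast
  show "Hausdorff_space (subtopology X A)"
    by (simp add: Hausdorff Hausdorff_space_subtopology)
  show "total_on (topspace (subtopology X A)) R"
    using total_R by (auto simp: total_on_def)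
  show "\<exists>W. openin (subtopology X A) W \<and> x \<in> W \<and> (\<forall>w\<in>W. w = x \<or> (w, x) \<in> R)"
    if "x \<in> topspace (subtopology X A)" for x
  proof -
    have "x \<in> topspace X" "x \<in> A" using that by auto
    with right_separated obtain W where
      "openin X W" "x \<in> W" "\<forall>w\<in>W. w = x \<or> (w, x) \<in> R" by blast
    then show ?thesis using \<open>x \<in> A\<close>
      by (intro exI[of _ "W \<inter> A"]) (auto simp: openin_subtopology)
  qed
qed (auto simp: compact_L cont separates wf_R trans_R intro: continuous_map_from_subtopology)

lemma finite_has_last:
  assumes "finite I" "I \<noteq> {}" "I \<subseteq> topspace X"
  shows "\<exists>m\<in>I. \<forall>x\<in>I. x = m \<or> (x, m) \<in> R"
  using assms
proof (induction rule: finite_ne_induct)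
  case (insert i I)
  then obtain m where m: "m \<in> I" "\<forall>x\<in>I. x = m \<or> (x, m) \<in> R" by blast
  then consider "i = m" | "(i, m) \<in> R" | "(m, i) \<in> R"
    using total_R insert.prems by (auto simp: total_on_def)
  then show ?case
  proof cases
    case 3
    then have "\<forall>x\<in>I. (x, i) \<in> R" using m(2) trans_R by (metis transD)
    then show ?thesis by blast
  qed (use m in auto)
qed auto

text \<open>
  Finitely many open initial segments cover the compact set \<open>F\<close>, and the last of their end points
  bounds \<open>F\<close>. This is the analogue of the top Cantor--Bendixson level of a scattered compact set.
\<close>
lemma closed_has_last:
  assumes "closedin X F" "F \<noteq> {}"
  shows "\<exists>m\<in>F. \<forall>x\<in>F. x = m \<or> (x, m) \<in> R"
proof -
  have sub: "F \<subseteq> topspace X" using assms closedin_subset by blast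
  obtain W where W: "\<And>x. x \<in> F \<Longrightarrow> openin X (W x) \<and> x \<in> W x \<and> (\<forall>w\<in>W x. w = x \<or> (w, x) \<in> R)"
    using right_separated sub by (metis subsetD)
  have "compactin X F" using assms compact closedin_compact_space by blast
  moreover have "\<forall>U\<in>W ` F. openin X U" "F \<subseteq> \<Union>(W ` F)"
    using W by auto
  ultimately obtain \<V> where V: "finite \<V>" "\<V> \<subseteq> W ` F" "F \<subseteq> \<Union>\<V>"
    unfolding compactin_def by meson
  then obtain I where I: "finite I" "I \<subseteq> F" "\<V> = W ` I"
    by (metis finite_subset_image)
  then have "I \<noteq> {}" using V assms by auto
  then obtain m where m: "m \<in> I" "\<forall>x\<in>I. x = m \<or> (x, m) \<in> R"
    using finite_has_last[of I] I sub by blast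
  have "x = m \<or> (x, m) \<in> R" if "x \<in> F" for x
  proof -
    have "x \<in> \<Union>(W ` I)" using V(3) I(3) that by blast
    then obtain i where "i \<in> I" "x \<in> W i" by blast
    then have "x = i \<or> (x, i) \<in> R" "i = m \<or> (i, m) \<in> R" using W I m by auto
    then show ?thesis using trans_R by (metis transD)
  qed
  then show ?thesis using m I by blast
qed

definition last_point :: "'a set \<Rightarrow> 'a" where
  "last_point F = (SOME m. m \<in> F \<and> (\<forall>x\<in>F. x = m \<or> (x, m) \<in> R))"

lemma last_point:
  assumes "closedin X F" "F \<noteq> {}"
  shows "last_point F \<in> F" "x \<in> F \<Longrightarrow> x = last_point F \<or> (x, last_point F) \<in> R"
proof -
  have "last_point F \<in> F \<and> (\<forall>x\<in>F. x = last_point F \<or> (x, last_point F) \<in> R)"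
    unfolding last_point_def by (rule someI_ex) (use closed_has_last[OF assms] in blast)
  then show "last_point F \<in> F" "x \<in> F \<Longrightarrow> x = last_point F \<or> (x, last_point F) \<in> R" by auto
qed

text \<open>
  A set \<open>E\<close> of rational constraints \<open>p \<le> l x \<le> q\<close> selects one function of \<open>L\<close> that obeys
  them. Up to \<open>\<aleph>\<^sub>0\<close> there are no more interpolants for finitely many constraints at points of
  \<open>A\<close> than points of \<open>A\<close>, and on finitely many points of \<open>A\<close> they approximate every function in
  \<open>L\<close>. The default \<open>0\<close> for unsatisfiable constraints keeps every interpolant continuous.
\<close>
definition interpolant :: "('a \<times> rat \<times> rat) set \<Rightarrow> 'a \<Rightarrow> real" where
  "interpolant E = (if \<exists>l\<in>L. \<forall>(x, p, q)\<in>E. of_rat p \<le> l x \<and> l x \<le> of_rat q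
     then SOME l. l \<in> L \<and> (\<forall>(x, p, q)\<in>E. of_rat p \<le> l x \<and> l x \<le> of_rat q)
     else (\<lambda>x. 0))"

lemma interpolant:
  assumes "l \<in> L" "\<forall>(x, p, q)\<in>E. of_rat p \<le> l x \<and> l x \<le> of_rat q"
  shows "interpolant E \<in> L"
    "\<forall>(x, p, q)\<in>E. of_rat p \<le> interpolant E x \<and> interpolant E x \<le> of_rat q"
proof -
  have *: "\<exists>l. l \<in> L \<and> (\<forall>(x, p, q)\<in>E. of_rat p \<le> l x \<and> l x \<le> of_rat q)" using assms by blast
  have "interpolant E = (SOME l. l \<in> L \<and> (\<forall>(x, p, q)\<in>E. of_rat p \<le> l x \<and> l x \<le> of_rat q))"
    unfolding interpolant_def using assms by (subst if_P) blast+
  with someI_ex[OF *]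
  show "interpolant E \<in> L"
    "\<forall>(x, p, q)\<in>E. of_rat p \<le> interpolant E x \<and> interpolant E x \<le> of_rat q" by simp_all
qed

lemma continuous_map_interpolant: "continuous_map X euclideanreal (interpolant E)"
proof (cases "\<exists>l\<in>L. \<forall>(x, p, q)\<in>E. of_rat p \<le> l x \<and> l x \<le> of_rat q")
  case True
  then show ?thesis using interpolant(1) cont by blast
next
  case False
  then have "interpolant E = (\<lambda>x. 0)" unfolding interpolant_def by (subst if_not_P) blast+
  then show ?thesis by simp
qed

text \<open>
  A test \<open>(E, p, q)\<close> asks whether the interpolant of \<open>E\<close> takes a value between \<open>p\<close> and \<open>q\<close>; it is
  a test over \<open>A\<close> if its constraints sit at points of \<open>A\<close>.
\<close>
definition tests :: "'a set \<Rightarrow> (('a \<times> rat \<times> rat) set \<times> rat \<times> rat) set" where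
  "tests A = Fpow (A \<times> UNIV) \<times> UNIV"

definition solutions :: "(('a \<times> rat \<times> rat) set \<times> rat \<times> rat) set \<Rightarrow> 'a set" where
  "solutions D = {x \<in> topspace X.
     \<forall>(E, p, q)\<in>D. of_rat p \<le> interpolant E x \<and> interpolant E x \<le> of_rat q}"

text \<open>
  Saturation combines the two closure properties needed: whatever finitely many tests over \<open>A\<close> allow
  in \<open>X\<close> is witnessed in \<open>A\<close>, and the witness is the last one, which forces \<open>A\<close> to be closed.
  For \<open>D = {}\<close> it says that the last point of \<open>X\<close> lies in \<open>A\<close>, so a saturated set is nonempty
  unless \<open>X\<close> is empty.
\<close>
definition saturated :: "'a set \<Rightarrow> bool" where
  "saturated A \<longleftrightarrow> A \<subseteq> topspace X \<and>
     (\<forall>D\<in>Fpow (tests A). solutions D \<noteq> {} \<longrightarrow> last_point (solutions D) \<in> A)"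

lemma tests_mono: "A \<subseteq> B \<Longrightarrow> tests A \<subseteq> tests B"
  unfolding tests_def by (intro Sigma_mono Fpow_mono) auto

lemma Fpow_tests_iff:
  "D \<in> Fpow (tests A) \<longleftrightarrow>
     finite D \<and> (\<forall>d\<in>D. finite (fst d)) \<and> (\<Union>d\<in>D. fst ` fst d) \<subseteq> A"
proof -
  have *: "d \<in> tests A \<longleftrightarrow> finite (fst d) \<and> fst ` fst d \<subseteq> A" for d
    unfolding tests_def Fpow_def mem_Times_iff by auto
  then have "D \<subseteq> tests A \<longleftrightarrow> (\<forall>d\<in>D. finite (fst d) \<and> fst ` fst d \<subseteq> A)"
    by (meson subset_iff)
  then show ?thesis
    unfolding Fpow_def mem_Collect_eq UN_subset_iff by metis
qed

text \<open>Finitely many tests involve finitely many points, so saturation is a finitary condition.\<close>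
lemma Fpow_tests_Union_chain:
  assumes "D \<in> Fpow (tests (\<Union>\<C>))" "subset.chain UNIV \<C>" "\<C> \<noteq> {}"
  shows "\<exists>A\<in>\<C>. D \<in> Fpow (tests A)"
proof -
  have D: "finite D" "\<forall>d\<in>D. finite (fst d)" "(\<Union>d\<in>D. fst ` fst d) \<subseteq> \<Union>\<C>"
    using assms(1) unfolding Fpow_tests_iff by simp_all
  have "finite (\<Union>d\<in>D. fst ` fst d)" using D by simp
  then obtain A where "A \<in> \<C>" "(\<Union>d\<in>D. fst ` fst d) \<subseteq> A"
    using finite_subset_Union_chain[OF _ D(3) assms(3,2)] by blast
  then show ?thesis using D(1,2) unfolding Fpow_tests_iff by blast
qed

lemma closedin_solutions: "closedin X (solutions D)"
proof -
  have "closedin X {x \<in> topspace X. interpolant E x \<in> {of_rat p .. of_rat q}}" for E p q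
    by (rule closedin_continuous_map_preimage[OF continuous_map_interpolant]) simp
  then have "closedin X (\<Inter>(insert (topspace X)
      ((\<lambda>(E, p, q). {x \<in> topspace X. interpolant E x \<in> {of_rat p .. of_rat q}}) ` D)))"
    by (intro closedin_Inter) auto
  also have "\<Inter>(insert (topspace X)
      ((\<lambda>(E, p, q). {x \<in> topspace X. interpolant E x \<in> {of_rat p .. of_rat q}}) ` D)) = solutions D"
    by (auto simp: solutions_def)
  finally show ?thesis .
qed

text \<open>
  Among the finite sets of tests over \<open>A\<close> that \<open>y\<close> passes, take one whose solution set has the
  earliest last point \<open>m\<close>. Then \<open>m\<close> lies in \<open>A\<close>, and no test over \<open>A\<close> separates \<open>m\<close> from \<open>y\<close>: such
  a test would exclude \<open>m\<close> and thus move the last point further down.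
\<close>
lemma saturated_has_twin:
  assumes A: "saturated A" and y: "y \<in> topspace X"
  shows "\<exists>m\<in>A. \<forall>E\<in>Fpow (A \<times> UNIV). interpolant E m = interpolant E y"
proof -
  define \<D> where "\<D> = {D \<in> Fpow (tests A). y \<in> solutions D}"
  have "{} \<in> \<D>" using y by (auto simp: \<D>_def empty_in_Fpow solutions_def)
  then obtain D where D: "D \<in> \<D>"
    and min: "\<And>D'. (last_point (solutions D'), last_point (solutions D)) \<in> R \<Longrightarrow> D' \<notin> \<D>"
    using wfE_min[OF wf_inv_image[OF wf_R, of "\<lambda>D. last_point (solutions D)"], of _ \<D>]
    unfolding in_inv_image by metis
  define m where "m = last_point (solutions D)"
  have "solutions D \<noteq> {}" using D by (auto simp: \<D>_def)
  then have "m \<in> A" using A D by (auto simp: saturated_def \<D>_def m_def)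
  moreover have "interpolant E m = interpolant E y" if E: "E \<in> Fpow (A \<times> UNIV)" for E
  proof (rule ccontr)
    assume "interpolant E m \<noteq> interpolant E y"
    then obtain p q where pq: "of_rat p \<le> interpolant E y" "interpolant E y \<le> of_rat q"
        "\<not> (of_rat p \<le> interpolant E m \<and> interpolant E m \<le> of_rat q)"
      using rat_interval_separating by metis
    define D' where "D' = insert (E, p, q) D"
    have "D' \<in> \<D>"
      using D E pq y by (auto simp: \<D>_def D'_def Fpow_def tests_def solutions_def)
    then have "solutions D' \<noteq> {}" by (auto simp: \<D>_def)
    then have "last_point (solutions D') \<in> solutions D'" using last_point(1) closedin_solutions by blast
    then have "last_point (solutions D') \<in> solutions D" "last_point (solutions D') \<noteq> m"
      using pq by (auto simp: solutions_def D'_def)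
    then have "(last_point (solutions D'), m) \<in> R"
      using last_point(2)[OF closedin_solutions \<open>solutions D \<noteq> {}\<close>] by (auto simp: m_def)
    then show False using min \<open>D' \<in> \<D>\<close> m_def by blast
  qed
  ultimately show ?thesis by blast
qed

text \<open>
  A function \<open>l \<in> L\<close> with \<open>l y \<noteq> l z\<close> agrees on finitely many points of \<open>A\<close>, up to any precision,
  with interpolants, and those do not separate \<open>y\<close> from \<open>z\<close>. By compactness of \<open>L\<close> some function in
  \<open>L\<close> agrees with \<open>l\<close> on all of \<open>A\<close> and does not separate \<open>y\<close> from \<open>z\<close> either. By continuity it
  agrees with \<open>l\<close> on the closure of \<open>A\<close>, a contradiction.
\<close>
lemma interpolants_separate_closure:
  assumes yz: "y \<in> X closure_of A" "z \<in> X closure_of A"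
    and eq: "\<And>E. E \<in> Fpow (A \<times> UNIV) \<Longrightarrow> interpolant E y = interpolant E z"
  shows "y = z"
proof (rule ccontr)
  assume "y \<noteq> z"
  then obtain l where l: "l \<in> L" "l y \<noteq> l z"
    using separates yz by (meson in_closure_of)
  define H where "H = L \<inter> {f. f y = f z}"
  have coord: "continuous_on UNIV (\<lambda>f :: 'a \<Rightarrow> real. f x)" for x
    by simp
  have "closed {f :: 'a \<Rightarrow> real. f y = f z}"
    by (intro closed_Collect_eq coord)
  then have "compact H" unfolding H_def using compact_L by blast
  define I where "I = {(x, p, q). x \<in> A \<and> of_rat p \<le> l x \<and> l x \<le> of_rat q}"
  define C where "C = (\<lambda>(x, p, q). {f :: 'a \<Rightarrow> real. of_rat p \<le> f x \<and> f x \<le> of_rat q})"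
  have "H \<inter> (\<Inter>i\<in>I. C i) \<noteq> {}"
  proof (rule compact_imp_fip_image[OF \<open>compact H\<close>])
    show "closed (C i)" for i
      unfolding C_def split_beta
      by (intro closed_Collect_conj closed_Collect_le continuous_on_const coord)
    fix E assume E: "finite E" "E \<subseteq> I"
    then have "\<forall>(x, p, q)\<in>E. of_rat p \<le> l x \<and> l x \<le> of_rat q"
      by (auto simp: I_def)
    note interpolant = interpolant[OF l(1) this]
    have "E \<in> Fpow (A \<times> UNIV)" using E by (auto simp: I_def Fpow_def)
    then have "interpolant E \<in> H" using eq interpolant(1) by (simp add: H_def)
    moreover have "interpolant E \<in> (\<Inter>i\<in>E. C i)" using interpolant(2) by (auto simp: C_def)
    ultimately show "H \<inter> (\<Inter>i\<in>E. C i) \<noteq> {}" by blast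
  qed
  then obtain f where f: "f \<in> H" "\<And>i. i \<in> I \<Longrightarrow> f \<in> C i" by blast
  have "f x = l x" if "x \<in> A" for x
  proof (rule ccontr)
    assume "f x \<noteq> l x"
    then obtain p q where "of_rat p \<le> l x" "l x \<le> of_rat q"
        "\<not> (of_rat p \<le> f x \<and> f x \<le> of_rat q)"
      using rat_interval_separating by metis
    then show False using f(2)[of "(x, p, q)"] that by (simp add: I_def C_def)
  qed
  then have "f w = l w" if "w \<in> X closure_of A" for w
    using forall_in_closure_of_eq[of w X A euclideanreal f l] that f(1) l(1) cont
    by (simp add: H_def)
  then show False using f(1) l(2) yz by (simp add: H_def)
qed

text \<open>For saturated \<open>A\<close> this is the canonical retraction of \<open>X\<close> onto \<open>A\<close>.\<close>
definition ret :: "'a set \<Rightarrow> 'a \<Rightarrow> 'a" where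
  "ret A y = (SOME m. m \<in> A \<and> (\<forall>E\<in>Fpow (A \<times> UNIV). interpolant E m = interpolant E y))"

lemma ret:
  assumes "saturated A" "y \<in> topspace X"
  shows "ret A y \<in> A" "E \<in> Fpow (A \<times> UNIV) \<Longrightarrow> interpolant E (ret A y) = interpolant E y"
proof -
  have "ret A y \<in> A \<and> (\<forall>E\<in>Fpow (A \<times> UNIV). interpolant E (ret A y) = interpolant E y)"
    unfolding ret_def by (rule someI_ex) (use saturated_has_twin[OF assms] in blast)
  then show "ret A y \<in> A" "E \<in> Fpow (A \<times> UNIV) \<Longrightarrow> interpolant E (ret A y) = interpolant E y" by auto
qed

lemma saturated_subset: "saturated A \<Longrightarrow> A \<subseteq> topspace X"
  by (simp add: saturated_def)

text \<open>
  A point of the closure of \<open>A\<close> and its twin in \<open>A\<close> are both in the closure and agree under all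
  interpolants over \<open>A\<close>, so they coincide.
\<close>
lemma closedin_saturated:
  assumes "saturated A"
  shows "closedin X A"
proof -
  have sub: "A \<subseteq> X closure_of A" by (simp add: assms closure_of_subset saturated_subset)
  have "y \<in> A" if "y \<in> X closure_of A" for y
  proof -
    have y: "y \<in> topspace X" using that by (meson in_closure_of)
    have "ret A y = y"
      by (rule interpolants_separate_closure[of _ A]) (use sub that ret[OF assms y] in auto)
    then show ?thesis using ret(1)[OF assms y] by simp
  qed
  then have "X closure_of A = A" using sub by blast
  then show ?thesis using closure_of_eq by blast
qed

lemma ret_eqI:
  assumes "saturated A" "y \<in> topspace X" "m \<in> A"
    and "\<And>E. E \<in> Fpow (A \<times> UNIV) \<Longrightarrow> interpolant E m = interpolant E y"
  shows "ret A y = m"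
  by (rule interpolants_separate_closure[of _ A])
    (use assms ret[OF assms(1,2)] closedin_saturated[OF assms(1)] in \<open>simp_all add: closure_of_closedin\<close>)

lemma ret_id: "saturated A \<Longrightarrow> y \<in> A \<Longrightarrow> ret A y = y"
  using saturated_subset by (intro ret_eqI) auto

lemma ret_ret:
  assumes "saturated A" "saturated B" "A \<subseteq> B" "y \<in> topspace X"
  shows "ret A (ret B y) = ret A y"
proof (rule ret_eqI)
  show "ret B y \<in> topspace X" using ret(1) saturated_subset assms by blast
  have "Fpow (A \<times> UNIV) \<subseteq> Fpow (B \<times> UNIV)"
    using assms(3) by (intro Fpow_mono) auto
  then show "interpolant E (ret A y) = interpolant E (ret B y)" if "E \<in> Fpow (A \<times> UNIV)" for E
    using ret(2) assms that by (metis subsetD)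
qed (use assms ret in auto)

text \<open>
  The graph of the retraction is closed in \<open>X \<times> X\<close>, being cut out by equations between continuous
  functions, and the projection along a compact factor is a closed map.
\<close>
lemma continuous_map_ret:
  assumes A: "saturated A"
  shows "continuous_map X X (ret A)"
  unfolding continuous_map_closedin
proof (intro conjI allI impI ballI funcsetI)
  show "ret A y \<in> topspace X" if "y \<in> topspace X" for y
    using ret(1) saturated_subset A that by blast
  fix C assume C: "closedin X C"
  define G where "G = {v \<in> topspace (prod_topology X X). snd v \<in> A \<inter> C} \<inter>
     (\<Inter>E\<in>Fpow (A \<times> UNIV). {v \<in> topspace (prod_topology X X). interpolant E (fst v) = interpolant E (snd v)})"
  have "closedin (prod_topology X X) {v \<in> topspace (prod_topology X X). snd v \<in> A \<inter> C}"
    by (rule closedin_continuous_map_preimage[OF continuous_map_snd])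
      (use C closedin_saturated[OF A] in blast)
  moreover have "closedin (prod_topology X X)
      {v \<in> topspace (prod_topology X X). interpolant E (fst v) = interpolant E (snd v)}" for E
    by (rule closedin_continuous_maps_eq[where Y = euclideanreal])
      (auto intro!: continuous_map_compose[OF continuous_map_fst continuous_map_interpolant, unfolded o_def]
        continuous_map_compose[OF continuous_map_snd continuous_map_interpolant, unfolded o_def])
  ultimately have "closedin (prod_topology X X) G"
    unfolding G_def by (intro closedin_Int closedin_INT) (auto simp: Fpow_not_empty)
  then have "closedin X (fst ` G)"
    using Abstract_Topological_Spaces.closed_map_fst[OF compact, of X]
    by (simp add: closed_map_def)
  also have "fst ` G = {y \<in> topspace X. ret A y \<in> C}"
  proof safe
    fix y c assume G: "(y, c) \<in> G"
    then have y: "y \<in> topspace X" by (simp add: G_def)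
    then have "ret A y = c"
      using G by (intro ret_eqI[OF A]) (auto simp: G_def)
    with y G show "fst (y, c) \<in> topspace X" "ret A (fst (y, c)) \<in> C" by (auto simp: G_def)
  next
    fix y assume y: "y \<in> topspace X" "ret A y \<in> C"
    then have "(y, ret A y) \<in> G"
      using ret[OF A y(1)] saturated_subset[OF A] by (auto simp: G_def)
    then show "y \<in> fst ` G" by force
  qed
  finally show "closedin X {y \<in> topspace X. ret A y \<in> C}" .
qed

lemma saturated_Union_chain:
  assumes saturated: "\<And>A. A \<in> \<C> \<Longrightarrow> saturated A" and chain: "subset.chain UNIV \<C>" and "\<C> \<noteq> {}"
  shows "saturated (\<Union>\<C>)"
  unfolding saturated_def
proof (intro conjI ballI impI)
  show "\<Union>\<C> \<subseteq> topspace X" using saturated saturated_subset by blast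
  fix D assume D: "D \<in> Fpow (tests (\<Union>\<C>))" "solutions D \<noteq> {}"
  then obtain A where A: "A \<in> \<C>" "D \<in> Fpow (tests A)"
    using Fpow_tests_Union_chain chain assms(3) by blast
  then show "last_point (solutions D) \<in> \<Union>\<C>"
    using saturated[OF A(1)] D(2) A(1) by (auto simp: saturated_def)
qed

definition extend :: "'a set \<Rightarrow> 'a set" where
  "extend A = A \<union> (\<lambda>D. last_point (solutions D)) ` {D \<in> Fpow (tests A). solutions D \<noteq> {}}"

primrec stage :: "'a set \<Rightarrow> nat \<Rightarrow> 'a set" where
  "stage S 0 = S"
| "stage S (Suc n) = extend (stage S n)"

definition saturation :: "'a set \<Rightarrow> 'a set" where
  "saturation S = (\<Union>n. stage S n)"

lemma extend_mono: "A \<subseteq> B \<Longrightarrow> extend A \<subseteq> extend B"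
  unfolding extend_def using Fpow_mono[OF tests_mono] by blast

lemma saturation_mono:
  assumes "A \<subseteq> B"
  shows "saturation A \<subseteq> saturation B"
proof -
  have "stage A n \<subseteq> stage B n" for n
    by (induction n) (simp_all add: assms extend_mono)
  then show ?thesis unfolding saturation_def by blast
qed

lemma subset_saturation: "S \<subseteq> saturation S"
  unfolding saturation_def using UN_upper[of 0 UNIV "stage S"] by simp

lemma saturated_saturation:
  assumes "S \<subseteq> topspace X"
  shows "saturated (saturation S)"
proof -
  define A where "A = stage S"
  have sat: "saturation S = \<Union>(range A)" by (simp add: saturation_def A_def)
  have step: "A (Suc n) = extend (A n)" for n by (simp add: A_def)
  have "incseq A" by (rule incseq_SucI) (auto simp: step extend_def)
  then have "A i \<subseteq> A j \<or> A j \<subseteq> A i" for i j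
    using nat_le_linear[of i j] by (auto dest: incseqD)
  then have chain: "subset.chain UNIV (range A)"
    unfolding subset_chain_def by blast
  have sub: "A n \<subseteq> topspace X" for n
  proof (induction n)
    case 0
    then show ?case using assms by (simp add: A_def)
  next
    case (Suc n)
    have "last_point (solutions D) \<in> topspace X" if "solutions D \<noteq> {}" for D
      using last_point(1)[OF closedin_solutions that] closedin_subset[OF closedin_solutions] by blast
    then show ?case using Suc by (auto simp: step extend_def)
  qed
  show ?thesis
    unfolding saturated_def
  proof (intro conjI ballI impI)
    show "saturation S \<subseteq> topspace X" using sub by (auto simp: sat)
    fix D assume D: "D \<in> Fpow (tests (saturation S))" "solutions D \<noteq> {}"
    then obtain n where "D \<in> Fpow (tests (A n))"
      using Fpow_tests_Union_chain[OF _ chain] unfolding sat by blast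
    then have "last_point (solutions D) \<in> A (Suc n)" using D by (auto simp: step extend_def)
    then show "last_point (solutions D) \<in> saturation S" by (auto simp: sat)
  qed
qed

text \<open>
  Over a set no larger than the infinite set \<open>C\<close> there are at most \<open>C\<close> many finite sets of tests,
  because the bounds in them are rational.
\<close>
lemma saturation_lepoll:
  assumes "S \<lesssim> C" "infinite C"
  shows "saturation S \<lesssim> C"
proof -
  have rat: "(UNIV :: (rat \<times> rat) set) \<lesssim> C"
  proof -
    have "(UNIV :: (rat \<times> rat) set) \<lesssim> (UNIV :: nat set)"
      unfolding lepoll_def by (intro exI[of _ to_nat]) simp
    also have "(UNIV :: nat set) \<lesssim> C" using assms(2) infinite_le_lepoll by blast
    finally show ?thesis .
  qed
  have "stage S n \<lesssim> C" for n
  proof (induction n)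
    case 0
    then show ?case using assms by simp
  next
    case (Suc n)
    let ?A = "stage S n"
    have "(\<lambda>D. last_point (solutions D)) ` {D \<in> Fpow (tests ?A). solutions D \<noteq> {}}
        \<lesssim> {D \<in> Fpow (tests ?A). solutions D \<noteq> {}}"
      by (rule image_lepoll)
    also have "\<dots> \<lesssim> Fpow (tests ?A)"
      by (intro subset_imp_lepoll) blast
    also have "Fpow (tests ?A) \<lesssim> C"
      unfolding tests_def by (rule Fpow_lepoll[OF Times_lepoll[OF Fpow_lepoll[OF Times_lepoll]]])
        (use Suc rat assms(2) in simp_all)
    finally show ?case using Suc assms(2) unfolding stage.simps extend_def by (intro Un_lepoll)
  qed
  moreover have "(UNIV :: nat set) \<lesssim> C" using assms(2) infinite_le_lepoll by blast
  ultimately show ?thesis unfolding saturation_def by (rule UN_lepoll[OF _ _ assms(2)])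
qed

end

section \<open>Induction on the cardinality\<close>

text \<open>The elements with finitely many predecessors in \<open>J\<close> form an initial piece of order type \<open>\<omega>\<close>.\<close>
lemma infinite_has_ascending_subset:
  assumes wf: "wf s" and trans: "trans s" and total: "total_on J s" and J: "infinite J"
  shows "\<exists>K\<subseteq>J. K \<noteq> {} \<and> (\<forall>b\<in>K. \<exists>b'\<in>K. (b, b') \<in> s)"
proof -
  define K where "K = {b \<in> J. finite {c \<in> J. (c, b) \<in> s}}"
  have "infinite K"
  proof
    assume "finite K"
    then have "infinite (J - K)" using J by (rule Diff_infinite_finite)
    then have "J - K \<noteq> {}" by (rule infinite_imp_nonempty)
    then obtain b where b: "b \<in> J - K" and min: "\<And>c. (c, b) \<in> s \<Longrightarrow> c \<notin> J - K"
      using wfE_min'[OF wf] by metis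
    have "{c \<in> J. (c, b) \<in> s} \<subseteq> K" using min by blast
    then have "finite {c \<in> J. (c, b) \<in> s}" using \<open>finite K\<close> by (rule finite_subset)
    then have "b \<in> K" using b by (simp add: K_def)
    then show False using b by blast
  qed
  moreover have "\<exists>b'\<in>K. (b, b') \<in> s" if b: "b \<in> K" for b
  proof -
    have "finite (insert b {c \<in> J. (c, b) \<in> s})" using b by (simp add: K_def)
    then have "\<not> K \<subseteq> insert b {c \<in> J. (c, b) \<in> s}"
      using \<open>infinite K\<close> finite_subset by metis
    then obtain b' where "b' \<in> K" "b' \<notin> insert b {c \<in> J. (c, b) \<in> s}" by blast
    then show ?thesis using total b by (auto simp: total_on_def K_def)
  qed
  moreover have "K \<subseteq> J" by (auto simp: K_def)
  moreover have "K \<noteq> {}" using \<open>infinite K\<close> by (rule infinite_imp_nonempty)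
  ultimately show ?thesis by blast
qed

text \<open>The cardinality of \<open>A\<close>, as an initial ordinal, has no initial segment as large as itself.\<close>
lemma well_order_short_segments:
  obtains s :: "'a rel" where "wf s" "trans s" "total_on A s"
    "\<And>x. x \<in> A \<Longrightarrow> {z. (z, x) \<in> s} \<subseteq> A"
    "\<And>x. x \<in> A \<Longrightarrow> \<not> A \<lesssim> {z. (z, x) \<in> s}"
proof -
  define r where "r = card_of A"
  have wo: "well_order_on A r" unfolding r_def by (rule card_of_well_order_on)
  define s where "s = r - Id"
  note s = well_order_on_strict_part[OF wo, folded s_def]
  have seg: "{z. (z, x) \<in> s} = Order_Relation.underS r x" for x
    by (auto simp: s_def Order_Relation.underS_def)
  have F: "Field r = A" unfolding r_def by (rule Field_card_of)
  have sub: "{z. (z, x) \<in> s} \<subseteq> A" for x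
    using F by (auto simp: s_def Field_def)
  have "\<not> A \<lesssim> {z. (z, x) \<in> s}" if "x \<in> A" for x
  proof -
    have "ordLess2 (card_of (Order_Relation.underS r x)) (card_of A)"
      using card_of_underS[of r x] card_of_Card_order[of A] that F unfolding r_def by simp
    then show ?thesis
      unfolding seg lepoll_def card_of_ordLeq using not_ordLess_ordLeq by blast
  qed
  then show thesis by (rule that[OF s sub])
qed

text \<open>
  Well-order \<open>X\<close> in the order type of its cardinality and let \<open>N b\<close> be the saturation of the initial
  segment up to \<open>b\<close>, and \<open>B b\<close> the union of the earlier sets \<open>N c\<close>. Each \<open>N b\<close> is smaller than \<open>X\<close>,
  so it has a point-finite assignment \<open>U b\<close> by induction. A point \<open>w\<close> enters the family at a unique
  stage \<open>\<beta> w\<close>, and its neighbourhood consists of the points whose retract onto \<open>N (\<beta> w)\<close> is in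
  \<open>U (\<beta> w) w\<close> and is new at that stage. This is point-finite if for each \<open>y\<close> the retract
  of \<open>y\<close> is new at finitely many stages only. If it were new at infinitely many, choose such
  stages \<open>K\<close> without a greatest one. The union of the sets \<open>N b\<close> with \<open>b \<in> K\<close> is saturated, hence
  contains the retract of \<open>y\<close> onto it; that retract already lies in one of the sets \<open>N b\<close> and so is
  the retract of \<open>y\<close> at each later stage in \<open>K\<close>, where it is not new.
\<close>
lemma point_finite_nbhds_compact_separation:
  assumes "compact_separation X L R"
  shows "point_finite_nbhds X"
  using assms
proof (induction "card_of (topspace X)" arbitrary: X rule: wf_induct_rule[OF wf_ordLess])
  case (1 X)
  interpret compact_separation X L R by (rule 1)
  show ?case
  proof (cases "countable (topspace X)")
    case True
    then show ?thesis
      using Hausdorff Hausdorff_imp_t1_space point_finite_nbhds_countable by blast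
  next
    case uncountable: False
    obtain s where s: "wf s" "trans s" "total_on (topspace X) s"
      and seg_sub: "\<And>x. x \<in> topspace X \<Longrightarrow> {z. (z, x) \<in> s} \<subseteq> topspace X"
      and seg: "\<And>x. x \<in> topspace X \<Longrightarrow> \<not> topspace X \<lesssim> {z. (z, x) \<in> s}"
      using well_order_short_segments[of "topspace X"] by blast
    define N where "N x = saturation (insert x {z. (z, x) \<in> s})" for x
    define B where "B x = (\<Union>z\<in>{z. (z, x) \<in> s}. N z)" for x
    have sat_N: "saturated (N x)" if "x \<in> topspace X" for x
      unfolding N_def using that seg_sub[OF that] by (intro saturated_saturation) blast
    have self: "x \<in> N x" for x
      unfolding N_def using subset_saturation by blast
    have N_mono: "N x \<subseteq> N y" if "(x, y) \<in> s" for x y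
      unfolding N_def
      by (rule saturation_mono) (use that \<open>trans s\<close> in \<open>auto dest: transD\<close>)
    have chain: "subset.chain UNIV (N ` K)" if "K \<subseteq> topspace X" for K
    proof -
      have "N x \<subseteq> N y \<or> N y \<subseteq> N x" if "x \<in> K" "y \<in> K" for x y
      proof -
        have "x = y \<or> (x, y) \<in> s \<or> (y, x) \<in> s"
          using s(3) \<open>K \<subseteq> topspace X\<close> that unfolding total_on_def by blast
        then show ?thesis using N_mono by blast
      qed
      then show ?thesis unfolding subset_chain_def by blast
    qed
    \<comment> \<open>The union over a nonempty chain is saturated; at the least \<open>x\<close> the set \<open>B x\<close> is empty.\<close>
    have closed_B: "closedin X (B x)" if "x \<in> topspace X" for x
    proof (cases "{z. (z, x) \<in> s} = {}")
      case False
      then have "saturated (B x)"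
        unfolding B_def using sat_N seg_sub[OF that]
        by (intro saturated_Union_chain chain) auto
      then show ?thesis by (rule closedin_saturated)
    qed (simp add: B_def)
    \<comment> \<open>Over a finite initial segment the saturation may be countably infinite, but \<open>X\<close> is uncountable.\<close>
    have small: "ordLess2 (card_of (N x)) (card_of (topspace X))" if x: "x \<in> topspace X" for x
    proof -
      have "\<not> topspace X \<lesssim> N x"
      proof (cases "finite {z. (z, x) \<in> s}")
        case True
        then have "insert x {z. (z, x) \<in> s} \<lesssim> (UNIV :: nat set)"
          by (intro finite_lepoll_infinite) auto
        then have N: "N x \<lesssim> (UNIV :: nat set)"
          unfolding N_def by (intro saturation_lepoll) auto
        then show ?thesis
          using uncountable countable_lepoll[OF countableI_type] lepoll_trans[OF _ N]
          by metis
      next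
        case False
        then have N: "N x \<lesssim> {z. (z, x) \<in> s}"
          unfolding N_def by (intro saturation_lepoll infinite_insert_lepoll)
        then show ?thesis using seg[OF x] lepoll_trans[OF _ N] by metis
      qed
      then show ?thesis
        unfolding lepoll_def card_of_ordLeq
        using not_ordLeq_iff_ordLess[OF card_of_Well_order card_of_Well_order] by blast
    qed
    have "\<exists>U. (\<forall>w\<in>N x. openin (subtopology X (N x)) (U w) \<and> w \<in> U w) \<and>
        (\<forall>y\<in>N x. finite {w \<in> N x. y \<in> U w})" if x: "x \<in> topspace X" for x
    proof -
      have top: "topspace (subtopology X (N x)) = N x"
        using saturated_subset[OF sat_N[OF x]] by (simp add: inf_absorb2)
      have "point_finite_nbhds (subtopology X (N x))"
      proof (rule 1(1))
        show "(card_of (topspace (subtopology X (N x))), card_of (topspace X)) \<in> ordLess"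
          unfolding top by (rule small[OF x])
        show "compact_separation (subtopology X (N x)) L R"
          by (intro compact_separation_closed_subspace closedin_saturated sat_N x)
      qed
      then show ?thesis unfolding point_finite_nbhds_def top .
    qed
    then have "\<forall>x\<in>topspace X. \<exists>U. (\<forall>w\<in>N x. openin (subtopology X (N x)) (U w) \<and> w \<in> U w) \<and>
        (\<forall>y\<in>N x. finite {w \<in> N x. y \<in> U w})" by (rule ballI)
    from bchoice[OF this] obtain U where U0:
      "\<forall>x\<in>topspace X. (\<forall>w\<in>N x. openin (subtopology X (N x)) (U x w) \<and> w \<in> U x w) \<and>
        (\<forall>y\<in>N x. finite {w \<in> N x. y \<in> U x w})" by (rule exE)
    have U: "openin (subtopology X (N x)) (U x w) \<and> w \<in> U x w"
      if "x \<in> topspace X" "w \<in> N x" for x w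
      using U0 that by simp
    have fin: "finite {w \<in> N x. y \<in> U x w}" if "x \<in> topspace X" "y \<in> N x" for x y
      using U0 that by simp
    have "\<exists>b\<in>topspace X. w \<in> N b - B b" if w: "w \<in> topspace X" for w
    proof -
      define Q where "Q = {b \<in> topspace X. w \<in> N b}"
      have "w \<in> Q" using w self by (simp add: Q_def)
      then obtain b where b: "b \<in> Q" and min: "\<forall>c. (c, b) \<in> s \<longrightarrow> c \<notin> Q"
        using s(1)[unfolded wf_eq_minimal] by blast
      have "b \<in> topspace X" "w \<in> N b" using b by (simp_all add: Q_def)
      moreover from this have "w \<notin> B b" using min seg_sub[of b] by (auto simp: B_def Q_def)
      ultimately show ?thesis by blast
    qed
    then obtain \<beta> where \<beta>: "\<And>w. w \<in> topspace X \<Longrightarrow> \<beta> w \<in> topspace X \<and> w \<in> N (\<beta> w) - B (\<beta> w)"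
      by metis
    define O' where "O' w = {y \<in> topspace X. ret (N (\<beta> w)) y \<in> U (\<beta> w) w - B (\<beta> w)}" for w
    have "openin X (O' w) \<and> w \<in> O' w" if w: "w \<in> topspace X" for w
    proof
      let ?b = "\<beta> w"
      have b: "?b \<in> topspace X" "w \<in> N ?b" "w \<notin> B ?b" using \<beta>[OF w] by auto
      obtain W where W: "openin X W" "U ?b w = W \<inter> N ?b"
        using U[OF b(1,2)] openin_subtopology by metis
      have "O' w = {y \<in> topspace X. ret (N ?b) y \<in> W - B ?b}"
        using ret(1)[OF sat_N[OF b(1)]] by (auto simp: O'_def W)
      moreover have "openin X {y \<in> topspace X. ret (N ?b) y \<in> W - B ?b}"
        by (rule openin_continuous_map_preimage[OF continuous_map_ret[OF sat_N[OF b(1)]]])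
          (use W closed_B[OF b(1)] in blast)
      ultimately show "openin X (O' w)" by simp
      show "w \<in> O' w"
        using w b U[OF b(1,2)] ret_id[OF sat_N[OF b(1)] b(2)] by (simp add: O'_def)
    qed
    moreover have "finite {w \<in> topspace X. y \<in> O' w}" if y: "y \<in> topspace X" for y
    proof -
      define J where "J = {b \<in> topspace X. ret (N b) y \<notin> B b}"
      have "finite J"
      proof (rule ccontr)
        assume "infinite J"
        moreover have "total_on J s" using s(3) by (auto simp: J_def total_on_def)
        ultimately obtain K where K: "K \<subseteq> J" "K \<noteq> {}" "\<forall>b\<in>K. \<exists>b'\<in>K. (b, b') \<in> s"
          using infinite_has_ascending_subset[OF s(1,2)] by meson
        have KX: "K \<subseteq> topspace X" using K(1) by (auto simp: J_def)
        have sat_H: "saturated (\<Union>(N ` K))"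
          using sat_N KX K(2) by (intro saturated_Union_chain chain) auto
        then obtain b where b: "b \<in> K" "ret (\<Union>(N ` K)) y \<in> N b"
          using ret(1)[OF _ y] by blast
        then obtain b' where b': "b' \<in> K" "(b, b') \<in> s" using K(3) by blast
        then have "b' \<in> topspace X" using KX by blast
        have "ret (N b') y = ret (N b') (ret (\<Union>(N ` K)) y)"
          using ret_ret[OF sat_N sat_H _ y] b'(1) \<open>b' \<in> topspace X\<close> by (metis UN_upper)
        also have "\<dots> = ret (\<Union>(N ` K)) y"
          using ret_id[OF sat_N] \<open>b' \<in> topspace X\<close> b(2) N_mono[OF b'(2)] by blast
        finally have "ret (N b') y \<in> B b'" using b(2) b'(2) by (auto simp: B_def)
        then show False using b'(1) K(1) by (auto simp: J_def)
      qed
      moreover have "finite {w \<in> N b. ret (N b) y \<in> U b w}" if "b \<in> J" for b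
        using fin[of b "ret (N b) y"] ret(1)[OF sat_N y] that by (auto simp: J_def)
      ultimately have "finite (\<Union>b\<in>J. {w \<in> N b. ret (N b) y \<in> U b w})" by blast
      moreover have "{w \<in> topspace X. y \<in> O' w} \<subseteq> (\<Union>b\<in>J. {w \<in> N b. ret (N b) y \<in> U b w})"
      proof
        fix w assume "w \<in> {w \<in> topspace X. y \<in> O' w}"
        then have w: "w \<in> topspace X" and r: "ret (N (\<beta> w)) y \<in> U (\<beta> w) w - B (\<beta> w)"
          by (auto simp: O'_def)
        then have "\<beta> w \<in> J" "w \<in> N (\<beta> w)" using \<beta>[OF w] by (simp_all add: J_def)
        then show "w \<in> (\<Union>b\<in>J. {w \<in> N b. ret (N b) y \<in> U b w})" using r by blast
      qed
      ultimately show ?thesis by (rule rev_finite_subset)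
    qed
    ultimately show ?thesis
      unfolding point_finite_nbhds_def by blast
  qed
qed

section \<open>Functions separating the points of an Eberlein compact space\<close>

text \<open>
  Functionals on \<open>V\<close> are extended by \<open>0\<close> to the ambient space, so that the dual unit ball becomes a
  closed subset of a product of compact intervals.
\<close>
lemma compact_dual_unit_ball:
  fixes V :: "'b::real_vector set" and N :: "'b \<Rightarrow> real"
  shows "compact {\<phi>. (\<forall>x\<in>V. \<forall>y\<in>V. \<phi> (x + y) = \<phi> x + \<phi> y) \<and> (\<forall>c. \<forall>x\<in>V. \<phi> (c *\<^sub>R x) = c * \<phi> x) \<and>
      (\<forall>x\<in>V. \<bar>\<phi> x\<bar> \<le> N x) \<and> (\<forall>x. x \<notin> V \<longrightarrow> \<phi> x = 0)}" (is "compact ?S")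
proof -
  define I where "I x = (if x \<in> V then {- N x..N x} else {0})" for x
  have "compactin (product_topology (\<lambda>x :: 'b. euclideanreal) UNIV) (Pi\<^sub>E UNIV I)"
    by (auto simp: compactin_PiE I_def)
  then have comp: "compact (Pi\<^sub>E UNIV I)"
    by (simp only: euclidean_product_topology compactin_euclidean_iff)
  define A where "A = (\<Inter>x\<in>V. \<Inter>y\<in>V. {\<phi> :: 'b \<Rightarrow> real. \<phi> (x + y) = \<phi> x + \<phi> y})"
  define S where "S = (\<Inter>c. \<Inter>x\<in>V. {\<phi> :: 'b \<Rightarrow> real. \<phi> (c *\<^sub>R x) = c * \<phi> x})"
  have "closed A" "closed S" unfolding A_def S_def
    by (intro closed_INT ballI closed_Collect_eq continuous_on_add continuous_on_mult_left
        continuous_on_product_coordinates)+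
  then have "compact (Pi\<^sub>E UNIV I \<inter> (A \<inter> S))" using comp by (intro compact_Int_closed closed_Int)
  also have "Pi\<^sub>E UNIV I \<inter> (A \<inter> S) = ?S"
    by (fastforce simp: PiE_iff I_def A_def S_def abs_le_iff split: if_splits)
  finally show ?thesis .
qed

text \<open>
  The functions are the restrictions of the dual unit ball to the copy of \<open>X\<close> in the Banach space.
  They separate points because points on which all bounded functionals agree have the same weak
  neighbourhoods, whereas \<open>X\<close> is Hausdorff.
\<close>
lemma eberlein_compact_separating_functions:
  fixes X :: "'a topology"
  assumes "eberlein_compact TYPE('b::real_vector) X"
  shows "\<exists>L. compact L \<and> (\<forall>l\<in>L. continuous_map X euclideanreal l) \<and>
     (\<forall>x\<in>topspace X. \<forall>y\<in>topspace X. x \<noteq> y \<longrightarrow> (\<exists>l\<in>L. l x \<noteq> l y))"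
proof -
  obtain V :: "'b set" and N K where
    H: "Hausdorff_space X" and ban: "banach_space_on V N" and
    hom: "X homeomorphic_space subtopology (weak_topology_on V N) K"
    using assms unfolding eberlein_compact_def by blast
  define W where "W = weak_topology_on V N"
  obtain h g where hg: "homeomorphic_maps X (subtopology W K) h g"
    using hom unfolding homeomorphic_space_def W_def by blast
  then have h: "continuous_map X W h"
    unfolding homeomorphic_maps_def by (simp add: continuous_map_in_subtopology)
  have hV: "h x \<in> V" if "x \<in> topspace X" for x
    using continuous_map_image_subset_topspace[OF h] that by (auto simp: W_def)
  define \<Lambda> where "\<Lambda> = {\<phi>. (\<forall>x\<in>V. \<forall>y\<in>V. \<phi> (x + y) = \<phi> x + \<phi> y) \<and> (\<forall>c. \<forall>x\<in>V. \<phi> (c *\<^sub>R x) = c * \<phi> x) \<and>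
      (\<forall>x\<in>V. \<bar>\<phi> x\<bar> \<le> N x) \<and> (\<forall>x. x \<notin> V \<longrightarrow> \<phi> x = 0)}"
  define L where "L = (\<lambda>\<phi> x. \<phi> (h x)) ` \<Lambda>"
  have bounded: "\<phi> \<in> bounded_functionals_on V N" if "\<phi> \<in> \<Lambda>" for \<phi>
    using that unfolding \<Lambda>_def bounded_functionals_on_def by (auto intro!: exI[of _ 1])
  have "compact L"
    unfolding L_def
  proof (rule compact_continuous_image)
    show "compact \<Lambda>" unfolding \<Lambda>_def by (rule compact_dual_unit_ball)
    show "continuous_on \<Lambda> (\<lambda>\<phi> x. \<phi> (h x))"
      by (intro continuous_on_coordinatewise_then_product
          continuous_on_subset[OF continuous_on_product_coordinates] subset_UNIV)
  qed
  moreover have "continuous_map X euclideanreal l" if l: "l \<in> L" for l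
  proof -
    obtain \<phi> where \<phi>: "\<phi> \<in> \<Lambda>" "l = \<phi> \<circ> h" using l by (auto simp: L_def o_def)
    have "continuous_map W euclideanreal \<phi>"
      unfolding continuous_map_def
    proof (intro conjI allI impI)
      fix U :: "real set" assume "openin euclideanreal U"
      then have "{x \<in> V. \<phi> x \<in> U} \<in> {{x \<in> V. f x \<in> U} |f U. f \<in> bounded_functionals_on V N \<and> open U}"
        using bounded[OF \<phi>(1)] by auto
      then show "openin W {x \<in> topspace W. \<phi> x \<in> U}"
        unfolding W_def topspace_weak_topology_on
        unfolding weak_topology_on_def by (rule topology_generated_by_Basis)
    qed auto
    then show ?thesis using h continuous_map_compose \<phi>(2) by blast
  qed
  moreover have "\<exists>l\<in>L. l x \<noteq> l y" if xy: "x \<in> topspace X" "y \<in> topspace X" "x \<noteq> y" for x y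
  proof (rule ccontr)
    assume "\<not> (\<exists>l\<in>L. l x \<noteq> l y)"
    then have eq: "\<phi> (h x) = \<phi> (h y)" if "\<phi> \<in> \<Lambda>" for \<phi> using that by (auto simp: L_def)
    have all_eq: "f (h x) = f (h y)" if f: "f \<in> bounded_functionals_on V N" for f
    proof -
      obtain C where C: "\<forall>x\<in>V. \<bar>f x\<bar> \<le> C * N x"
        using f by (auto simp: bounded_functionals_on_def)
      \<comment> \<open>Dividing by \<open>c\<close> brings \<open>f\<close> into the unit ball; the summand \<open>1\<close> makes \<open>c\<close> positive.\<close>
      define c where "c = \<bar>C\<bar> + 1"
      have "c > 0" by (simp add: c_def)
      have V: "subspace V" and N: "\<forall>x\<in>V. 0 \<le> N x" using ban by (auto simp: banach_space_on_def)
      have "\<bar>f z\<bar> \<le> c * N z" if "z \<in> V" for z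
      proof -
        have "C * N z \<le> c * N z"
          using N that by (intro mult_right_mono) (auto simp: c_def)
        then show ?thesis using C that by fastforce
      qed
      then have "(\<lambda>z. if z \<in> V then f z / c else 0) \<in> \<Lambda>"
        using f V \<open>c > 0\<close>
        by (auto simp: \<Lambda>_def bounded_functionals_on_def subspace_add subspace_scale
            add_divide_distrib pos_divide_le_eq mult.commute)
      from eq[OF this] show ?thesis using hV xy \<open>c > 0\<close> by simp
    qed
    have same: "h x \<in> G \<longleftrightarrow> h y \<in> G" if "openin W G" for G
    proof -
      have "generate_topology_on {{x \<in> V. f x \<in> U} |f U. f \<in> bounded_functionals_on V N \<and> open U} G"
        using that unfolding W_def weak_topology_on_def by (rule openin_topology_generated_by)
      then show ?thesis
      proof induction
        case (Basis s)
        then obtain f U where "s = {x \<in> V. f x \<in> U}" "f \<in> bounded_functionals_on V N"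
          by blast
        then show ?case using all_eq[of f] hV xy by simp
      qed auto
    qed
    have "Hausdorff_space (subtopology W K)"
      using H hom homeomorphic_Hausdorff_space unfolding W_def by blast
    moreover have "h x \<in> topspace (subtopology W K)" "h y \<in> topspace (subtopology W K)" "h x \<noteq> h y"
      using hg xy unfolding homeomorphic_maps_def continuous_map_def by (fastforce, fastforce, metis)
    ultimately obtain G G' where "openin (subtopology W K) G" "openin (subtopology W K) G'"
        "h x \<in> G" "h y \<in> G'" "disjnt G G'"
      unfolding Hausdorff_space_def by metis
    then show False
      using same unfolding openin_subtopology disjnt_def by blast
  qed
  ultimately show ?thesis by blast
qed

section \<open>The \<sigma>-product\<close>

lemma scattered_eberlein_point_finite_nbhds:
  fixes X :: "'a topology"
  assumes "scattered_space X" and E: "eberlein_compact TYPE('b::real_vector) X"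
  shows "point_finite_nbhds X"
proof -
  obtain L where "compact L" "\<forall>l\<in>L. continuous_map X euclideanreal l"
      "\<forall>x\<in>topspace X. \<forall>y\<in>topspace X. x \<noteq> y \<longrightarrow> (\<exists>l\<in>L. l x \<noteq> l y)"
    using eberlein_compact_separating_functions[OF E] by (elim exE conjE)
  moreover obtain R where "wf R" "trans R" "total_on (topspace X) R"
      "\<forall>x\<in>topspace X. \<exists>W. openin X W \<and> x \<in> W \<and> (\<forall>w\<in>W. w = x \<or> (w, x) \<in> R)"
    using scattered_space_right_separated[OF assms(1)] by (elim exE conjE)
  moreover have "compact_space X" "Hausdorff_space X"
    using E by (simp_all add: eberlein_compact_def)
  ultimately have "compact_separation X L R"
    by unfold_locales simp_all
  then show ?thesis by (rule point_finite_nbhds_compact_separation)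
qed

theorem corollary2p4:
  fixes X :: "'i \<Rightarrow> 'a topology" and T :: "'i set" and a :: "'i \<Rightarrow> 'a"
  assumes "\<And>t. t \<in> T \<Longrightarrow> scattered_space (X t)"
    and "\<And>t. t \<in> T \<Longrightarrow> eberlein_compact TYPE('b::real_vector) (X t)"
    and "a \<in> topspace (product_topology X T)"
  shows "delta_space (sigma_product X T a)"
proof (intro point_finite_nbhds_imp_delta_space point_finite_nbhds_sigma_product assms(3))
  fix t assume t: "t \<in> T"
  have "Hausdorff_space (X t)"
    using assms(2)[OF t] by (simp add: eberlein_compact_def)
  then show "t1_space (X t)" by (simp add: Hausdorff_imp_t1_space)
  show "point_finite_nbhds (X t)"
    by (rule scattered_eberlein_point_finite_nbhds[OF assms(1)[OF t] assms(2)[OF t]])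
qed

end
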